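(* Let $d\ge1$ and $N=(n_1,\dots,n_d)$ a $d$-tuple of positive integers. For any $s\in\mathbf{C}$ with $\mathrm{Re}(s^2)>0$, $$\sum_{\Lambda_j\neq0}\log(s^2+\Lambda_j)=V(N)\mathcal{I}_d(s)+\mathcal{H}_N(s).$$ Letting $s\to0$, $$\log\Big(\prod_{\Lambda_j\neq0}\Lambda_j\Big)=V(N)\mathcal{I}_d(0)+\mathcal{H}_N(0),$$ where $$\mathcal{I}_d(0)=-\int_0^\infty\left(e^{-2dt}I_0(2t)^d-e^{-t}\right)\frac{dt}{t},\qquad \mathcal{H}_N(0)=-\int_0^\infty\left(\theta_N(t)-V(N)e^{-2dt}I_0(2t)^d-1+e^{-t}\right)\frac{dt}{t}.$$
   Context: $\{\Lambda_j\}$ is the multiset $\{2d-\sum_{i=1}^d2\cos(2\pi k_i/n_i):0\le k_i<n_i\}$ of eigenvalues of the combinatorial Laplacian on the discrete torus $\prod_i n_i\mathbf{Z}\backslash\mathbf{Z}$ (exactly one is zero); $V(N)=n_1\cdots n_d$; $\theta_N(t)=\sum_j e^{-\Lambda_j t}$. The logarithm is the principal branch. $I_0(t)=\frac1\pi\int_0^\pi e^{t\cos\theta}d\theta$ is the modified Bessel function. For $\mathrm{Re}(s^2)>0$, $$\mathcal{I}_d(s)=-\int_0^\infty\left(e^{-s^2t}e^{-2dt}I_0(2t)^d-e^{-t}\right)\frac{dt}{t},\qquad \mathcal{H}_N(s)=-\int_0^\infty\left(e^{-s^2t}\left[\theta_N(t)-V(N)e^{-2dt}I_0(2t)^d-1\right]+e^{-t}\right)\frac{dt}{t}.$$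 *)

theory Defs
  imports "HOL-Analysis.Analysis"
begin

text \<open>A \<open>d\<close>-tuple \<open>(n\<^sub>1, \<dots>, n\<^sub>d)\<close> is given by \<open>d\<close> and a function \<open>n :: nat \<Rightarrow> nat\<close>
  of which only the values on \<open>{1..d}\<close> matter.  All integrals are Lebesgue integrals; integrals over
  \<open>(0, \<infinity>)\<close> are taken over \<open>{0<..}\<close>, so the value \<open>x / 0 = 0\<close> plays no role.\<close>

definition torus_eigenvalues :: "nat \<Rightarrow> (nat \<Rightarrow> nat) \<Rightarrow> real multiset" where
  "torus_eigenvalues d n =
     image_mset (\<lambda>k. 2 * real d - (\<Sum>i=1..d. 2 * cos (2 * pi * real (k i) / real (n i))))
       (mset_set (PiE {1..d} (\<lambda>i. {0..<n i})))"

definition torus_volume :: "nat \<Rightarrow> (nat \<Rightarrow> nat) \<Rightarrow> nat" where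
  "torus_volume d n = (\<Prod>i=1..d. n i)"

definition torus_theta :: "nat \<Rightarrow> (nat \<Rightarrow> nat) \<Rightarrow> real \<Rightarrow> real" where
  "torus_theta d n t = (\<Sum>\<Lambda>\<in>#torus_eigenvalues d n. exp (- \<Lambda> * t))"

definition bessel_I0 :: "real \<Rightarrow> real" where
  "bessel_I0 t = 1 / pi * (LBINT \<theta>:{0..pi}. exp (t * cos \<theta>))"

definition calI_integrand :: "nat \<Rightarrow> complex \<Rightarrow> real \<Rightarrow> complex" where
  "calI_integrand d s t =
     (exp (- (s^2) * of_real t) * of_real (exp (- 2 * real d * t) * bessel_I0 (2 * t) ^ d)
      - of_real (exp (- t))) / of_real t"

definition calI :: "nat \<Rightarrow> complex \<Rightarrow> complex" where
  "calI d s = - (LBINT t:{0<..}. calI_integrand d s t)"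

definition calH_integrand :: "nat \<Rightarrow> (nat \<Rightarrow> nat) \<Rightarrow> complex \<Rightarrow> real \<Rightarrow> complex" where
  "calH_integrand d n s t =
     (exp (- (s^2) * of_real t) *
        of_real (torus_theta d n t
          - real (torus_volume d n) * exp (- 2 * real d * t) * bessel_I0 (2 * t) ^ d - 1)
      + of_real (exp (- t))) / of_real t"

definition calH :: "nat \<Rightarrow> (nat \<Rightarrow> nat) \<Rightarrow> complex \<Rightarrow> complex" where
  "calH d n s = - (LBINT t:{0<..}. calH_integrand d n s t)"

text \<open>The values at \<open>s = 0\<close>, which lies outside the domain \<open>Re (s\<^sup>2) > 0\<close> of \<^const>\<open>calI\<close> and
  \<^const>\<open>calH\<close>, are given by real integrals of their own.\<close>

definition calI_zero_integrand :: "nat \<Rightarrow> real \<Rightarrow> real" where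
  "calI_zero_integrand d t =
     (exp (- 2 * real d * t) * bessel_I0 (2 * t) ^ d - exp (- t)) / t"

definition calI_zero :: "nat \<Rightarrow> real" where
  "calI_zero d = - (LBINT t:{0<..}. calI_zero_integrand d t)"

definition calH_zero_integrand :: "nat \<Rightarrow> (nat \<Rightarrow> nat) \<Rightarrow> real \<Rightarrow> real" where
  "calH_zero_integrand d n t =
     (torus_theta d n t
      - real (torus_volume d n) * exp (- 2 * real d * t) * bessel_I0 (2 * t) ^ d - 1
      + exp (- t)) / t"

definition calH_zero :: "nat \<Rightarrow> (nat \<Rightarrow> nat) \<Rightarrow> real" where
  "calH_zero d n = - (LBINT t:{0<..}. calH_zero_integrand d n t)"

end

theory Submission
  imports Defs
begin

text \<open>
  Let \<open>B(t) = e\<^sup>-\<^sup>2\<^sup>d\<^sup>t I\<^sub>0(2t)\<^sup>d\<close>. In \<open>V(N) \<I>\<^sub>d(s) + \<H>\<^sub>N(s)\<close> the terms with \<open>B\<close> cancel, and what remains is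
  the sum over \<open>\<Lambda>\<^sub>j \<noteq> 0\<close> of the integrals of \<open>(e\<^sup>-\<^sup>t - exp (- (s\<^sup>2 + \<Lambda>\<^sub>j) t)) / t\<close>, which are
  \<open>Ln (s\<^sup>2 + \<Lambda>\<^sub>j)\<close> by Frullani's formula. Since \<open>1 - B(t) = O(t)\<close> at \<open>0\<close> and \<open>B(t) = O(t\<^sup>-\<^sup>1\<^sup>/\<^sup>2)\<close> at
  infinity, the integral \<open>\<I>\<^sub>d\<close> converges for all \<open>s\<close> with \<open>Re (s\<^sup>2) \<ge> 0\<close>, including \<open>s = 0\<close>, and is
  continuous at \<open>0\<close> by dominated convergence; the identity, valid for all such \<open>s\<close>, carries this over
  to \<open>\<H>\<^sub>N\<close>.
\<close>

section \<open>The complex Frullani integral\<close>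

text \<open>A gauge integral need not converge absolutely, but for a nonnegative integrand it is the
  Lebesgue integral. This transfers the known gauge integrals of exponentials and of powers on
  half-lines.\<close>

lemma set_integrable_lborel_nonneg:
  fixes f :: "real \<Rightarrow> real"
  assumes "(f has_integral I) A" and "\<And>x. x \<in> A \<Longrightarrow> 0 \<le> f x"
    and [measurable]: "f \<in> borel_measurable borel" "A \<in> sets borel"
  shows "set_integrable lborel A f" and "(LBINT x:A. f x) = I"
proof -
  have "has_bochner_integral lborel (\<lambda>x. indicator A x *\<^sub>R f x) I"
  proof (rule has_bochner_integral_nn_integral)
    have "(\<lambda>x. indicator A x *\<^sub>R f x) = (\<lambda>x. if x \<in> A then f x else 0)"
      by (auto simp: indicator_def)
    then have "((\<lambda>x. indicator A x *\<^sub>R f x) has_integral I) UNIV"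
      using assms(1) by (simp only: has_integral_restrict_UNIV)
    then show "(\<integral>\<^sup>+x. ennreal (indicator A x *\<^sub>R f x) \<partial>lborel) = ennreal I"
      by (intro nn_integral_has_integral_lborel) (auto simp: indicator_def assms)
    show "0 \<le> I"
      using assms(1,2) by (rule has_integral_nonneg)
  qed (use assms in \<open>auto simp: indicator_def\<close>)
  then show "set_integrable lborel A f" "(LBINT x:A. f x) = I"
    by (auto simp: has_bochner_integral_iff set_integrable_def set_lebesgue_integral_def)
qed

lemma set_integral_exp_minus_to_infinity:
  fixes a :: real
  assumes "a > 0"
  shows "set_integrable lborel {0<..} (\<lambda>t. exp (- a * t))"
    and "(LBINT t:{0<..}. exp (- a * t)) = 1 / a"
proof -
  have "((\<lambda>t. exp (- a * t)) has_integral 1 / a) {0..}"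
    using has_integral_exp_minus_to_infinity[OF assms, of 0] by simp
  \<comment> \<open>The known integral is over the closed half-line; passing to the open one removes
    only the null set \<open>{0}\<close>.\<close>
  moreover have "{x \<in> {0..} - {0<..}. exp (- a * x) \<noteq> 0} = {0}" "{x \<in> {0<..} - {0..}. exp (- a * x) \<noteq> 0} = {}"
    by auto
  ultimately have int: "((\<lambda>t. exp (- a * t)) has_integral 1 / a) {0<..}"
    using has_integral_spike_set_eq[of "{0..}" "{0<..}" "\<lambda>t. exp (- a * t)"]
    by (metis negligible_empty negligible_sing)
  show "set_integrable lborel {0<..} (\<lambda>t. exp (- a * t))"
    and "(LBINT t:{0<..}. exp (- a * t)) = 1 / a"
    using set_integrable_lborel_nonneg[OF int] by simp_all
qed

text \<open>The norm of the integrand is \<open>exp (- Re w * t)\<close>, which gives integrability;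
  the value comes from the primitive \<open>- exp (- (w * t)) / w\<close>, which vanishes at
  infinity because \<open>Re w > 0\<close>.\<close>

lemma set_integral_cexp_minus_to_infinity:
  fixes w :: complex
  assumes "Re w > 0"
  shows "set_integrable lborel {0<..} (\<lambda>t. exp (- (w * of_real t)))"
    and "(LBINT t:{0<..}. exp (- (w * of_real t))) = 1 / w"
proof -
  show int: "set_integrable lborel {0<..} (\<lambda>t. exp (- (w * of_real t)))"
    by (rule set_integrable_bound[OF set_integral_exp_minus_to_infinity(1)[OF assms]])
      (auto simp: set_borel_measurable_def)
  have w: "w \<noteq> 0" using assms by auto
  have "(LBINT t=ereal 0..\<infinity>. exp (- (w * of_real t))) = 0 - (- 1 / w)"
  proof (rule interval_integral_FTC_integrable[where F = "\<lambda>t. - exp (- (w * of_real t)) / w"])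
    show "((\<lambda>t. - exp (- (w * of_real t)) / w) has_vector_derivative exp (- (w * of_real x))) (at x)"
      for x :: real
      using w by (auto intro!: derivative_eq_intros has_vector_derivative_real_field)
    show "set_integrable lborel (einterval (ereal 0) \<infinity>) (\<lambda>t. exp (- (w * of_real t)))"
      using int by (simp add: einterval_def greaterThan_def)
    have "((\<lambda>t. - exp (- (w * of_real t)) / w) \<longlongrightarrow> - 1 / w) (at_right 0)"
      using w by (auto intro!: tendsto_eq_intros)
    then show "(((\<lambda>t. - exp (- (w * of_real t)) / w) \<circ> real_of_ereal) \<longlongrightarrow> - 1 / w) (at_right (ereal 0))"
      by (simp add: ereal_tendsto_simps)
    have "((\<lambda>t. - exp (- (w * of_real t)) / w) \<longlongrightarrow> 0) at_top"
    proof (rule tendsto_norm_zero_cancel)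
      have "((\<lambda>t. exp (- (Re w * t))) \<longlongrightarrow> 0) at_top"
        using assms 
        by (intro filterlim_compose[OF exp_at_bot] filterlim_uminus_at_bot_at_top[THEN filterlim_compose]
             filterlim_tendsto_pos_mult_at_top[OF tendsto_const _ filterlim_ident])
      then show "((\<lambda>t. norm (- exp (- (w * of_real t)) / w)) \<longlongrightarrow> 0) at_top"
        by (auto simp: norm_divide intro!: tendsto_divide_zero)
    qed
    then show "(((\<lambda>t. - exp (- (w * of_real t)) / w) \<circ> real_of_ereal) \<longlongrightarrow> 0) (at_left \<infinity>)"
      by (simp add: ereal_tendsto_simps)
  qed auto
  then show "(LBINT t:{0<..}. exp (- (w * of_real t))) = 1 / w"
    by (simp add: interval_lebesgue_integral_def einterval_def greaterThan_def)
qed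

text \<open>Fubini applied to \<open>(1 - z) exp (- (1 + u (z - 1)) t)\<close> on \<open>[0, 1] \<times> (0, \<infinity>)\<close>: the segment from
  \<open>1\<close> to \<open>z\<close> stays in the right half plane, where \<^const>\<open>Ln\<close> is a primitive of \<open>1 / w\<close>.\<close>

lemma complex_frullani:
  fixes z :: complex
  assumes z: "Re z > 0"
  shows "set_integrable lborel {0<..} (\<lambda>t. (exp (- (z * of_real t)) - of_real (exp (- t))) / of_real t)"
    and "(LBINT t:{0<..}. (exp (- (z * of_real t)) - of_real (exp (- t))) / of_real t) = - Ln z"
proof -
  define w where "w u = 1 + of_real u * (z - 1)" for u :: real
  \<comment> \<open>The indicators cut the integrand off outside the rectangle, so Fubini can be
    applied on the whole plane.\<close>
  define f :: "real \<Rightarrow> real \<Rightarrow> complex" where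
    "f u t = indicator {0..1} u *\<^sub>R indicator {0<..} t *\<^sub>R ((1 - z) * exp (- (w u * of_real t)))" for u t
  have w01: "w 0 = 1" "w 1 = z" by (simp_all add: w_def)
  have w_pos: "Re (w u) > 0" if "u \<in> {0..1}" for u
  proof -
    have "Re (w u) = (1 - u) + u * Re z" by (simp add: w_def algebra_simps)
    moreover have "(1 - u) + u * Re z > 0"
      using that z by (cases "u = 1") (auto intro!: add_pos_nonneg)
    ultimately show ?thesis by simp
  qed
  have [measurable]: "w \<in> borel_measurable borel"
    unfolding w_def by measurable
  \<comment> \<open>Integration in \<open>t\<close> for fixed \<open>u\<close>: \<open>t_val\<close>
    leads to the integral of \<open>1 / w\<close> along the segment, \<open>t_norm\<close> supplies
    the absolute bound that Fubini requires.\<close>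
  have t_int: "integrable lborel (f u)" 
    and t_val: "(\<integral>t. f u t \<partial>lborel) = indicator {0..1} u *\<^sub>R ((1 - z) / w u)" 
    and t_norm: "(\<integral>t. norm (f u t) \<partial>lborel) = indicator {0..1} u *\<^sub>R (norm (1 - z) / Re (w u))" for u
  proof -
    show "integrable lborel (f u)"
    proof (cases "u \<in> {0..1}")
      case True
      then show ?thesis
        using set_integrable_mult_right[OF set_integral_cexp_minus_to_infinity(1)[OF w_pos[OF True]], of "1 - z"]
        by (simp add: f_def[abs_def] set_integrable_def)
    qed (simp add: f_def[abs_def])
    show "(\<integral>t. f u t \<partial>lborel) = indicator {0..1} u *\<^sub>R ((1 - z) / w u)"
    proof (cases "u \<in> {0..1}")
      case True
      then have "(\<integral>t. f u t \<partial>lborel) = (LBINT t:{0<..}. (1 - z) * exp (- (w u * of_real t)))"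
        unfolding f_def set_lebesgue_integral_def by simp
      also have "\<dots> = (1 - z) / w u"
        using set_integral_cexp_minus_to_infinity(2)[OF w_pos[OF True]] by simp
      finally show ?thesis using True by simp
    qed (simp add: f_def[abs_def])
    show "(\<integral>t. norm (f u t) \<partial>lborel) = indicator {0..1} u *\<^sub>R (norm (1 - z) / Re (w u))"
    proof (cases "u \<in> {0..1}")
      case True
      then have "(\<integral>t. norm (f u t) \<partial>lborel) = (LBINT t:{0<..}. norm (1 - z) * exp (- Re (w u) * t))"
        unfolding f_def set_lebesgue_integral_def by (simp add: norm_mult mult_ac)
      also have "\<dots> = norm (1 - z) / Re (w u)"
        using set_integral_exp_minus_to_infinity(2)[OF w_pos[OF True]] by simp
      finally show ?thesis using True by simp
    qed (simp add: f_def[abs_def])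
  qed
  \<comment> \<open>Integration in \<open>u\<close> for fixed \<open>t\<close> recovers the Frullani
    integrand, since \<open>exp (- (w u * t)) / t\<close> is a primitive in
    \<open>u\<close>.\<close>
  have u_val: "(\<integral>u. f u t \<partial>lborel)
      = indicator {0<..} t *\<^sub>R ((exp (- (z * of_real t)) - of_real (exp (- t))) / of_real t)" for t
  proof (cases "t > 0")
    case True
    have "(\<integral>u. indicator {0..1} u *\<^sub>R ((1 - z) * exp (- (w u * of_real t))) \<partial>lborel)
        = exp (- (w 1 * of_real t)) / of_real t - exp (- (w 0 * of_real t)) / of_real t"
    proof (rule integral_FTC_Icc)
      show "((\<lambda>u. exp (- (w u * of_real t)) / of_real t) has_vector_derivative
          (1 - z) * exp (- (w u * of_real t))) (at u within {0..1})" for u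
        using True unfolding w_def
        by (auto intro!: derivative_eq_intros has_vector_derivative_real_field simp: field_simps)
    qed (auto simp: w_def intro!: continuous_intros)
    moreover have "exp (- complex_of_real t) = of_real (exp (- t))"
      by (metis exp_of_real of_real_minus)
    ultimately show ?thesis
      using True by (simp add: f_def w01 diff_divide_distrib)
  qed (simp add: f_def)
  have prod: "integrable (lborel \<Otimes>\<^sub>M lborel) (case_prod f)"
  proof (rule lborel_pair.Fubini_integrable)
    show "case_prod f \<in> borel_measurable (lborel \<Otimes>\<^sub>M lborel)"
      unfolding f_def split_beta' by measurable
    \<comment> \<open>\<open>Re (w u)\<close> stays positive on the compact segment, so the
      integrated norms form a continuous, hence integrable, function of \<open>u\<close>.\<close>
    have "continuous_on {0..1} (\<lambda>u. norm (1 - z) / Re (w u))"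
      using w_pos unfolding w_def by (intro continuous_intros) (auto simp: less_le)
    then have "integrable lborel (\<lambda>u. indicat_real {0..1} u *\<^sub>R (norm (1 - z) / Re (w u)))"
      by (intro borel_integrable_compact) auto
    then show "integrable lborel (\<lambda>u. \<integral>t. norm (case_prod f (u, t)) \<partial>lborel)"
      by (simp only: case_prod_conv t_norm)
  qed (simp add: t_int)
  show "set_integrable lborel {0<..} (\<lambda>t. (exp (- (z * of_real t)) - of_real (exp (- t))) / of_real t)"
    using lborel_pair.integrable_snd[OF prod] by (simp only: u_val set_integrable_def)
  have "(LBINT t:{0<..}. (exp (- (z * of_real t)) - of_real (exp (- t))) / of_real t)
      = (\<integral>t. \<integral>u. f u t \<partial>lborel \<partial>lborel)"
    by (simp only: u_val set_lebesgue_integral_def)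
  also have "\<dots> = (\<integral>u. indicator {0..1} u *\<^sub>R ((1 - z) / w u) \<partial>lborel)"
    by (simp only: lborel_pair.Fubini_integral[OF prod] t_val)
  also have "\<dots> = (- Ln (w 1)) - (- Ln (w 0))"
  proof (rule integral_FTC_Icc)
    fix u :: real assume "0 \<le> u" "u \<le> 1"
    then have "Re (w u) > 0" using w_pos by simp
    then have "1 + of_real u * (z - 1) \<notin> \<real>\<^sub>\<le>\<^sub>0"
      by (auto simp: w_def complex_nonpos_Reals_iff)
    then have "((\<lambda>u. - Ln (w u)) has_vector_derivative - ((z - 1) / w u)) (at u within {0..1})"
      unfolding w_def
      by (auto intro!: derivative_eq_intros has_vector_derivative_real_field
          simp: divide_inverse mult.commute)
    then show "((\<lambda>u. - Ln (w u)) has_vector_derivative (1 - z) / w u) (at u within {0..1})"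
      by (metis minus_diff_eq minus_divide_left)
  next
    have "w u \<noteq> 0" if "u \<in> {0..1}" for u using w_pos[OF that] by auto
    then show "continuous_on {0..1} (\<lambda>u. (1 - z) / w u)"
      unfolding w_def by (intro continuous_intros) auto
  qed simp
  finally show "(LBINT t:{0<..}. (exp (- (z * of_real t)) - of_real (exp (- t))) / of_real t) = - Ln z"
    by (simp add: w01)
qed

section \<open>The scaled Bessel function\<close>

text \<open>This is the heat kernel of the integers at the origin; its \<open>d\<close>-th power is
  the factor \<open>B(t)\<close>.\<close>

definition scaled_bessel :: "real \<Rightarrow> real" where
  "scaled_bessel t = exp (- 2 * t) * bessel_I0 (2 * t)"

text \<open>With the exponential absorbed, the exponent is nonpositive for \<open>t \<ge> 0\<close>.
  All bounds below are obtained by estimating \<open>1 - cos \<theta>\<close> under this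
  integral.\<close>

lemma scaled_bessel_eq:
  "scaled_bessel t = 1 / pi * (LBINT \<theta>:{0..pi}. exp (- (2 * t * (1 - cos \<theta>))))"
proof -
  have "scaled_bessel t = 1 / pi * (LBINT \<theta>:{0..pi}. exp (- 2 * t) * exp (2 * t * cos \<theta>))"
    by (simp add: scaled_bessel_def bessel_I0_def)
  then show ?thesis
    by (simp add: exp_add[symmetric] algebra_simps)
qed

lemma scaled_bessel_measurable [measurable]: "scaled_bessel \<in> borel_measurable borel"
  unfolding scaled_bessel_eq[abs_def] set_lebesgue_integral_def by measurable

lemma set_integrable_continuous_Icc:
  fixes f :: "real \<Rightarrow> real"
  assumes "continuous_on {a..b} f"
  shows "set_integrable lborel {a..b} f"
  using borel_integrable_compact[OF _ assms] by (simp add: set_integrable_def)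

lemma scaled_bessel_nonneg: "0 \<le> scaled_bessel t"
  unfolding scaled_bessel_eq set_lebesgue_integral_def
  by (intro mult_nonneg_nonneg integral_nonneg_AE) auto

lemma scaled_bessel_le_1:
  assumes "t \<ge> 0" shows "scaled_bessel t \<le> 1"
proof -
  have "(LBINT \<theta>:{0..pi}. exp (- (2 * t * (1 - cos \<theta>)))) \<le> (LBINT \<theta>:{0..pi}. 1)"
    using assms
    by (intro set_integral_mono set_integrable_continuous_Icc continuous_intros) auto
  then show ?thesis
    by (simp add: scaled_bessel_eq set_lebesgue_integral_def)
qed

text \<open>Since \<open>1 - cos \<theta> \<le> 2\<close>, the exponent is at least
  \<open>- 4 * t\<close>, and \<open>exp x \<ge> 1 + x\<close>. This linear bound compensates the
  factor \<open>1 / t\<close> near 0.\<close>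

lemma scaled_bessel_ge:
  assumes "t \<ge> 0" shows "scaled_bessel t \<ge> 1 - 4 * t"
proof -
  have "(LBINT \<theta>:{0..pi}. 1 - 4 * t) \<le> (LBINT \<theta>:{0..pi}. exp (- (2 * t * (1 - cos \<theta>))))"
  proof (intro set_integral_mono set_integrable_continuous_Icc continuous_intros)
    fix \<theta> :: real
    have "2 * t * (1 - cos \<theta>) \<le> 2 * t * 2"
      using assms by (intro mult_left_mono) auto
    then show "1 - 4 * t \<le> exp (- (2 * t * (1 - cos \<theta>)))"
      using exp_ge_add_one_self[of "- (2 * t * (1 - cos \<theta>))"] by linarith
  qed
  then show ?thesis
    by (simp add: scaled_bessel_eq set_lebesgue_integral_def field_simps)
qed

text \<open>A crude form of Jordan's inequality. Up to \<open>pi / 6\<close> the derivative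
  \<open>cos y - 1 / 4\<close> is positive because \<open>cos y \<ge> 1 / 2\<close>; beyond it
  \<open>sin x \<ge> 1 / 2\<close>, while \<open>x / 4 \<le> pi / 8 < 1 / 2\<close>.\<close>

lemma sin_ge_quarter:
  fixes x :: real
  assumes "0 \<le> x" "x \<le> pi / 2"
  shows "sin x \<ge> x / 4"
proof (cases "x \<le> pi / 6")
  case True
  have "sin 0 - 0 / 4 \<le> sin x - x / 4"
  proof (rule DERIV_nonneg_imp_nondecreasing[OF assms(1)])
    fix y :: real assume "0 \<le> y" "y \<le> x"
    then have "cos y \<ge> cos (pi / 3)"
      using True by (intro cos_monotone_0_pi_le) auto
    then show "\<exists>D. ((\<lambda>x. sin x - x / 4) has_real_derivative D) (at y) \<and> D \<ge> 0"
      by (intro exI[of _ "cos y - 1 / 4"]) (auto intro!: derivative_eq_intros simp: cos_60)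
  qed
  then show ?thesis by simp
next
  case False
  then have "sin x \<ge> sin (pi / 6)"
    using assms by (intro sin_monotone_2pi_le) auto
  then show ?thesis
    using assms pi_less_4 by (simp add: sin_30)
qed

text \<open>Half-angle formula: the left side is \<open>2 * (sin (\<theta> / 2))\<^sup>2\<close>,
  and \<open>sin (\<theta> / 2) \<ge> \<theta> / 8\<close>.\<close>

lemma one_minus_cos_ge:
  fixes \<theta> :: real
  assumes "0 \<le> \<theta>" "\<theta> \<le> pi"
  shows "1 - cos \<theta> \<ge> \<theta>\<^sup>2 / 32"
proof -
  have "(\<theta> / 8)\<^sup>2 \<le> (sin (\<theta> / 2))\<^sup>2"
    using sin_ge_quarter[of "\<theta> / 2"] assms by (intro power_mono) auto
  then show ?thesis
    using cos_double_sin[of "\<theta> / 2"] by (simp add: power_divide)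
qed

text \<open>The quadratic lower bound on \<open>1 - cos \<theta>\<close> gives a Gaussian majorant.
  Weakening it by \<open>exp x \<ge> 1 + x\<close> to \<open>1 / (1 + x)\<close> makes an arctangent
  the primitive, and arctangents are below \<open>pi / 2\<close>.\<close>

lemma scaled_bessel_decay:
  assumes "t > 0" shows "scaled_bessel t \<le> 2 / sqrt t"
proof -
  \<comment> \<open>Chosen so that
    \<open>(c * \<theta>)\<^sup>2 = 2 * t * (\<theta>\<^sup>2 / 32)\<close>.\<close>
  define c where "c = sqrt t / 4"
  have c: "c > 0" "c\<^sup>2 = t / 16"
    using assms by (auto simp: c_def power_divide)
  have pos: "1 + (c * x)\<^sup>2 > 0" for x by (intro add_pos_nonneg) auto
  then have nz: "1 + (c * x)\<^sup>2 \<noteq> 0" for x by (metis less_irrefl)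
  have cont: "continuous_on {0..pi} (\<lambda>x. 1 / (1 + (c * x)\<^sup>2))"
    using nz by (intro continuous_intros) auto
  have "(LBINT \<theta>:{0..pi}. exp (- (2 * t * (1 - cos \<theta>)))) \<le> (LBINT \<theta>:{0..pi}. 1 / (1 + (c * \<theta>)\<^sup>2))"
  proof (intro set_integral_mono set_integrable_continuous_Icc cont)
    fix \<theta> assume \<theta>: "\<theta> \<in> {0..pi}"
    have "2 * t * (\<theta>\<^sup>2 / 32) \<le> 2 * t * (1 - cos \<theta>)"
      using \<theta> assms one_minus_cos_ge[of \<theta>] by (intro mult_left_mono) auto
    then have "(c * \<theta>)\<^sup>2 \<le> 2 * t * (1 - cos \<theta>)"
      by (simp add: power_mult_distrib c)
    then have "1 + (c * \<theta>)\<^sup>2 \<le> exp (2 * t * (1 - cos \<theta>))"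
      using exp_ge_add_one_self[of "2 * t * (1 - cos \<theta>)"] by linarith
    then show "exp (- (2 * t * (1 - cos \<theta>))) \<le> 1 / (1 + (c * \<theta>)\<^sup>2)"
      using pos[of \<theta>] unfolding exp_minus inverse_eq_divide by (intro divide_left_mono) auto
  qed (intro continuous_intros)
  also have "\<dots> = arctan (c * pi) / c - arctan (c * 0) / c"
    unfolding set_lebesgue_integral_def
  proof (rule integral_FTC_Icc[OF pi_ge_zero _ cont])
    have "((\<lambda>x. arctan (c * x) / c) has_real_derivative inverse (1 + (c * x)\<^sup>2) * c / c)
        (at x within {0..pi})" for x
      by (auto intro!: derivative_eq_intros)
    then show "((\<lambda>x. arctan (c * x) / c) has_vector_derivative 1 / (1 + (c * x)\<^sup>2)) (at x within {0..pi})" for x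
      unfolding has_real_derivative_iff_has_vector_derivative[symmetric]
      using c by (simp add: inverse_eq_divide)
  qed
  also have "\<dots> \<le> (pi / 2) / c"
    using c divide_right_mono[of "arctan (c * pi)" "pi / 2" c] arctan_ubound[of "c * pi"] by simp
  finally have "(LBINT \<theta>:{0..pi}. exp (- (2 * t * (1 - cos \<theta>)))) \<le> 2 * pi / sqrt t"
    by (simp add: c_def)
  then have "1 / pi * (LBINT \<theta>:{0..pi}. exp (- (2 * t * (1 - cos \<theta>)))) \<le> 1 / pi * (2 * pi / sqrt t)"
    by (intro mult_left_mono) auto
  then show ?thesis by (simp add: scaled_bessel_eq)
qed

section \<open>The integral \<open>\<I>\<^sub>d\<close>\<close>

text \<open>Mean value inequality between \<open>w\<close> and 0 in the convex half plane
  \<open>Re w \<ge> 0\<close>, where the derivative of \<open>exp (- w)\<close> has norm at most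
  1.\<close>

lemma norm_cexp_minus_one_le:
  fixes w :: complex
  assumes "Re w \<ge> 0"
  shows "norm (exp (- w) - 1) \<le> norm w"
proof -
  have "norm (exp (- w) - exp (- 0)) \<le> 1 * norm (w - 0)"
  proof (rule field_differentiable_bound[where S = "{w. Re w \<ge> 0}" and f' = "\<lambda>w. - exp (- w)"])
    show "((\<lambda>w. exp (- w)) has_field_derivative - exp (- x)) (at x within {w. Re w \<ge> 0})" for x :: complex
      by (auto intro!: derivative_eq_intros)
  qed (use assms in \<open>auto simp: convex_halfspace_Re_ge\<close>)
  then show ?thesis by simp
qed

lemma calI_integrand_eq:
  "calI_integrand d s t =
     (exp (- (s^2 * of_real t)) * of_real (scaled_bessel t ^ d) - of_real (exp (- t))) / of_real t"
proof -
  have "exp (- 2 * real d * t) * bessel_I0 (2 * t) ^ d = scaled_bessel t ^ d"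
    by (simp add: scaled_bessel_def power_mult_distrib exp_of_nat_mult[symmetric] mult_ac)
  then show ?thesis by (simp add: calI_integrand_def)
qed

lemma calI_integrand_measurable [measurable]: "calI_integrand d s \<in> borel_measurable borel"
  unfolding calI_integrand_eq[abs_def] by measurable

text \<open>A majorant free of \<open>s\<close>, constant up to 1 and of order
  \<open>t powr (- 3 / 2)\<close> from there on. The constant \<open>4 * d + 2\<close> collects
  \<open>4 * d\<close> from \<open>B\<close>, 1 from \<open>exp (- t)\<close> and 1 for
  \<open>s\<^sup>2\<close> (scaled by \<open>C\<close> below); the 3 is 2 from the Bessel decay plus
  1 from \<open>exp (- t)\<close>.\<close>

definition calI_bound :: "nat \<Rightarrow> real \<Rightarrow> real" where
  "calI_bound d t = (4 * real d + 2) * indicator {0..1} t + 3 * (t powr (- 3 / 2) * indicator {1..} t)"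

lemma integrable_calI_bound: "integrable lborel (calI_bound d)"
proof -
  have "((\<lambda>t::real. t powr (- 3 / 2)) has_integral - (1 powr (- 3 / 2 + 1)) / (- 3 / 2 + 1)) {1..}"
    by (rule has_integral_powr_to_inf) auto
  then have "set_integrable lborel {1..} (\<lambda>t::real. t powr (- 3 / 2))"
    by (rule set_integrable_lborel_nonneg) auto
  then have "integrable lborel (\<lambda>t. t powr (- 3 / 2) * indicator {1..} t :: real)"
    by (simp add: set_integrable_def mult.commute)
  then show ?thesis
    unfolding calI_bound_def by (intro Bochner_Integration.integrable_add integrable_mult_right) auto
qed

text \<open>Near 0 the two terms of the numerator both differ from 1 by \<open>O(t)\<close>, which
  cancels the division by \<open>t\<close>; for large \<open>t\<close> both are
  \<open>O(1 / sqrt t)\<close>. The bound is uniform over \<open>norm (s\<^sup>2) \<le> C\<close>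
  and includes \<open>Re (s\<^sup>2) = 0\<close>, as the limit at 0 requires.\<close>

lemma norm_calI_integrand_le:
  assumes d: "d \<ge> 1" and s: "Re (s\<^sup>2) \<ge> 0" "norm (s\<^sup>2) \<le> C" and C: "C \<ge> 1" and t: "t > 0"
  shows "norm (calI_integrand d s t) \<le> C * calI_bound d t"
proof -
  let ?B = "scaled_bessel t ^ d"
  have B: "0 \<le> ?B" "?B \<le> 1"
    using scaled_bessel_nonneg scaled_bessel_le_1 t by (auto intro!: power_le_one)
  have E: "norm (exp (- (s\<^sup>2 * of_real t))) \<le> 1"
    using s t by simp
  have num: "norm (calI_integrand d s t) * t
      = norm (exp (- (s\<^sup>2 * of_real t)) * of_real ?B - of_real (exp (- t)))"
    using t by (simp add: calI_integrand_eq norm_divide)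
  show ?thesis
  proof (cases "t \<le> 1")
    case True
    \<comment> \<open>Bernoulli's inequality carries the linear bound from one Bessel factor to its
      \<open>d\<close>-th power.\<close>
    have "1 + real d * (scaled_bessel t - 1) \<le> (1 + (scaled_bessel t - 1)) ^ d"
      using scaled_bessel_nonneg[of t] by (intro Bernoulli_inequality) linarith
    moreover have "real d * (scaled_bessel t - 1) \<ge> real d * (- (4 * t))"
      using scaled_bessel_ge[of t] t by (intro mult_left_mono) auto
    ultimately have B1: "1 - ?B \<le> 4 * real d * t" by simp
    have "norm (exp (- (s\<^sup>2 * of_real t)) * of_real ?B - of_real (exp (- t)))
        = norm ((exp (- (s\<^sup>2 * of_real t)) - 1) * of_real ?B + of_real (?B - exp (- t)))"
      by (simp add: algebra_simps)
    also have "\<dots> \<le> norm (exp (- (s\<^sup>2 * of_real t)) - 1) * ?B + \<bar>?B - exp (- t)\<bar>"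
      by (rule norm_triangle_le) (use B in \<open>simp add: norm_mult flip: of_real_diff of_real_power\<close>)
    also have "\<dots> \<le> norm (s\<^sup>2 * of_real t) * 1 + (4 * real d * t + t)"
    proof (intro add_mono mult_mono norm_cexp_minus_one_le)
      show "\<bar>?B - exp (- t)\<bar> \<le> 4 * real d * t + t"
      proof (rule abs_leI)
        show "?B - exp (- t) \<le> 4 * real d * t + t"
          using B1 B exp_ge_add_one_self[of "- t"] by linarith
        have "exp (- t) \<le> 1" using t by simp
        then show "- (?B - exp (- t)) \<le> 4 * real d * t + t"
          using B1 t by linarith
      qed
    qed (use s t B in auto)
    also have "\<dots> \<le> C * t + C * (4 * real d * t + t)"
    proof (intro add_mono)
      show "norm (s\<^sup>2 * of_real t) * 1 \<le> C * t"
        using s t by (auto simp: norm_mult intro!: mult_right_mono)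
      show "4 * real d * t + t \<le> C * (4 * real d * t + t)"
        using C t mult_right_mono[of 1 C "4 * real d * t + t"] by simp
    qed
    also have "\<dots> = (C * (4 * real d + 2)) * t" by (simp add: algebra_simps)
    finally have "norm (calI_integrand d s t) \<le> C * (4 * real d + 2)"
      using t unfolding num[symmetric] by simp
    also have "\<dots> \<le> C * calI_bound d t"
      using True t C by (intro mult_left_mono) (auto simp: calI_bound_def)
    finally show ?thesis .
  next
    case False
    \<comment> \<open>Here \<open>d \<ge> 1\<close> enters: one factor provides the decay, the
      others are at most 1.\<close>
    have "?B \<le> scaled_bessel t ^ 1"
      using d scaled_bessel_nonneg scaled_bessel_le_1 t by (intro power_decreasing) auto
    then have B2: "?B \<le> 2 / sqrt t"
      using scaled_bessel_decay[OF t] by simp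
    \<comment> \<open>Through \<open>sqrt t \<le> t \<le> exp t\<close>, the term
      \<open>exp (- t)\<close> gets the same decay rate as \<open>B\<close>.\<close>
    have "sqrt t \<le> t"
      using False by (intro real_le_lsqrt) (auto simp: power2_eq_square)
    also have "t \<le> exp t"
      using exp_ge_add_one_self[of t] by linarith
    finally have e: "exp (- t) \<le> 1 / sqrt t"
      using t by (simp add: exp_minus inverse_eq_divide divide_left_mono)
    have "norm (calI_integrand d s t) * t \<le> norm (exp (- (s\<^sup>2 * of_real t))) * ?B + exp (- t)"
      unfolding num by (rule order_trans[OF norm_triangle_ineq4]) (use B in \<open>simp add: norm_mult flip: of_real_power\<close>)
    also have "\<dots> \<le> 1 * (2 / sqrt t) + 1 / sqrt t"
      by (intro add_mono mult_mono E B2 e) (use B in auto)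
    finally have "norm (calI_integrand d s t) \<le> (3 / sqrt t) / t"
      using t by (simp add: pos_le_divide_eq mult_ac)
    also have "\<dots> = 3 * t powr (- (1 / 2 + 1))"
      using t by (simp only: powr_minus powr_add powr_half_sqrt powr_one) (simp add: field_simps)
    also have "\<dots> = calI_bound d t"
      using False by (simp add: calI_bound_def)
    also have "\<dots> \<le> C * calI_bound d t"
      using C mult_right_mono[of 1 C "calI_bound d t"] by (simp add: calI_bound_def)
    finally show ?thesis .
  qed
qed

lemma calI_integrable:
  assumes "d \<ge> 1" "Re (s\<^sup>2) \<ge> 0"
  shows "set_integrable lborel {0<..} (calI_integrand d s)"
  unfolding set_integrable_def
proof (rule Bochner_Integration.integrable_bound)
  let ?C = "max 1 (norm (s\<^sup>2))"
  show "integrable lborel (\<lambda>t. ?C * calI_bound d t)"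
    by (intro integrable_mult_right integrable_calI_bound)
  have "norm (calI_integrand d s t) \<le> norm (?C * calI_bound d t)" if "t > 0" for t
    using norm_calI_integrand_le[OF assms _ _ that, of ?C] by simp
  then show "AE t in lborel. norm (indicat_real {0<..} t *\<^sub>R calI_integrand d s t) \<le> norm (?C * calI_bound d t)"
    by (intro AE_I2) (simp add: indicator_def)
qed simp

lemma calI_tendsto:
  assumes d: "d \<ge> 1"
  shows "(calI d \<longlongrightarrow> calI d 0) (at 0 within {s. Re (s\<^sup>2) > 0})"
  unfolding tendsto_at_iff_sequentially
proof (intro allI impI)
  fix X :: "nat \<Rightarrow> complex"
  assume X: "\<forall>i. X i \<in> {s. Re (s\<^sup>2) > 0} - {0}" and lim: "X \<longlonglongrightarrow> 0"
  \<comment> \<open>A convergent sequence is bounded, so a single \<open>C\<close> dominates the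
    integrands for all \<open>X i\<close>.\<close>
  have "Bseq (\<lambda>i. (X i)\<^sup>2)"
    using lim by (intro convergent_imp_Bseq convergentI[of _ "0\<^sup>2"] tendsto_power)
  then obtain K where K: "\<And>i. norm ((X i)\<^sup>2) \<le> K"
    unfolding Bseq_def by auto
  define C where "C = max 1 K"
  have "(\<lambda>i. \<integral>t. indicat_real {0<..} t *\<^sub>R calI_integrand d (X i) t \<partial>lborel)
      \<longlonglongrightarrow> (\<integral>t. indicat_real {0<..} t *\<^sub>R calI_integrand d 0 t \<partial>lborel)"
  proof (rule integral_dominated_convergence[where w = "\<lambda>t. indicator {0<..} t *\<^sub>R (C * calI_bound d t)"])
    show "integrable lborel (\<lambda>t. indicat_real {0<..} t *\<^sub>R (C * calI_bound d t))"
      by (intro integrable_mult_indicator integrable_mult_right integrable_calI_bound) auto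
    have "(\<lambda>i. calI_integrand d (X i) t) \<longlonglongrightarrow> calI_integrand d 0 t" if "t > 0" for t
      unfolding calI_integrand_eq using that by (intro tendsto_intros lim) simp
    then show "AE t in lborel. (\<lambda>i. indicat_real {0<..} t *\<^sub>R calI_integrand d (X i) t)
        \<longlonglongrightarrow> indicat_real {0<..} t *\<^sub>R calI_integrand d 0 t"
      by (intro AE_I2) (simp add: indicator_def)
    fix i
    have "norm (calI_integrand d (X i) t) \<le> C * calI_bound d t" if "t > 0" for t
      using X K[of i] that by (intro norm_calI_integrand_le d) (auto simp: C_def less_imp_le)
    then show "AE t in lborel. norm (indicat_real {0<..} t *\<^sub>R calI_integrand d (X i) t)
        \<le> indicat_real {0<..} t *\<^sub>R (C * calI_bound d t)"
      by (intro AE_I2) (simp add: indicator_def)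
  qed simp_all
  then show "(calI d \<circ> X) \<longlonglongrightarrow> calI d 0"
    unfolding calI_def comp_def set_lebesgue_integral_def by (rule tendsto_minus)
qed

text \<open>At \<open>s = 0\<close> the complex integrand is the embedded real one, so the limit
  value \<open>calI d 0\<close> is the separately defined real integral.\<close>

lemma calI_zero_eq:
  assumes "d \<ge> 1"
  shows "set_integrable lborel {0<..} (calI_zero_integrand d)" "calI d 0 = of_real (calI_zero d)"
proof -
  have eq: "calI_integrand d 0 = (\<lambda>t. of_real (calI_zero_integrand d t))"
    by (simp add: fun_eq_iff calI_integrand_def calI_zero_integrand_def)
  show "set_integrable lborel {0<..} (calI_zero_integrand d)"
    using calI_integrable[OF assms, of 0] unfolding eq set_integrable_def
    by (simp add: scaleR_conv_of_real complex_of_real_integrable_eq flip: of_real_mult)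
  show "calI d 0 = of_real (calI_zero d)"
    by (simp add: calI_def calI_zero_def eq set_integral_complex_of_real)
qed

section \<open>The spectrum of the torus\<close>

definition torus_eigenvalue :: "nat \<Rightarrow> (nat \<Rightarrow> nat) \<Rightarrow> (nat \<Rightarrow> nat) \<Rightarrow> real" where
  "torus_eigenvalue d n k = 2 * real d - (\<Sum>i=1..d. 2 * cos (2 * pi * real (k i) / real (n i)))"

text \<open>Summing over frequencies instead of eigenvalues keeps multiplicities while using a plain
  finite set. Members of \<open>PiE\<close> are \<open>undefined\<close> off \<open>{1..d}\<close>,
  so the zero frequency has to be a \<open>restrict\<close>.\<close>

definition torus_nonzero_freqs :: "nat \<Rightarrow> (nat \<Rightarrow> nat) \<Rightarrow> (nat \<Rightarrow> nat) set" where
  "torus_nonzero_freqs d n = PiE {1..d} (\<lambda>i. {0..<n i}) - {restrict (\<lambda>_. 0) {1..d}}"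

text \<open>Equality would make \<open>k / m\<close> an integer, impossible strictly between 0 and
  1.\<close>

lemma cos_frequency_less_1:
  fixes k m :: nat
  assumes "0 < k" "k < m"
  shows "cos (2 * pi * real k / real m) < 1"
proof -
  have "cos (2 * pi * real k / real m) \<noteq> 1"
  proof
    assume "cos (2 * pi * real k / real m) = 1"
    then obtain j :: int where "2 * pi * real k / real m = of_int j * 2 * pi"
      unfolding cos_one_2pi_int by auto
    then have "real k = of_int j * real m"
      using assms by (simp add: field_simps)
    then have "int k = j * int m"
      by (metis of_int_eq_iff of_int_mult of_int_of_nat_eq)
    then have "m dvd k"
      by (metis dvd_triv_right int_dvd_int_iff)
    then show False
      using assms by (auto dest: dvd_imp_le)
  qed
  then show ?thesis
    using cos_le_one[of "2 * pi * real k / real m"] by linarith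
qed

context
  fixes d :: nat and n :: "nat \<Rightarrow> nat"
  assumes n_pos: "\<And>i. i \<in> {1..d} \<Longrightarrow> n i \<ge> 1"
begin

lemma finite_torus_nonzero_freqs: "finite (torus_nonzero_freqs d n)"
  unfolding torus_nonzero_freqs_def by (intro finite_Diff finite_PiE) auto

lemma zero_freq_mem: "restrict (\<lambda>_. 0) {1..d} \<in> PiE {1..d} (\<lambda>i. {0..<n i})"
  using n_pos by (auto simp: Suc_le_eq)

lemma torus_volume_eq: "torus_volume d n = Suc (card (torus_nonzero_freqs d n))"
proof -
  have "torus_volume d n = card (PiE {1..d} (\<lambda>i. {0..<n i}))"
    by (simp add: torus_volume_def card_PiE)
  then show ?thesis
    unfolding torus_nonzero_freqs_def
    by (metis card_Suc_Diff1 zero_freq_mem finite_PiE finite_atLeastAtMost finite_atLeastLessThan)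
qed

text \<open>Every cosine is at most 1, and a nonzero coordinate of \<open>k\<close> makes one of
  them strictly smaller. Hence 0 is a simple eigenvalue, and each
  \<open>s\<^sup>2 + \<Lambda>\<close> has positive real part even when
  \<open>Re (s\<^sup>2) = 0\<close>.\<close>

lemma torus_eigenvalue_pos:
  assumes "k \<in> torus_nonzero_freqs d n"
  shows "torus_eigenvalue d n k > 0"
proof -
  have k: "k \<in> PiE {1..d} (\<lambda>i. {0..<n i})" "k \<noteq> restrict (\<lambda>_. 0) {1..d}"
    using assms by (auto simp: torus_nonzero_freqs_def)
  have "\<exists>i\<in>{1..d}. k i \<noteq> 0"
  proof (rule ccontr)
    assume "\<not> ?thesis"
    then have "k = restrict (\<lambda>_. 0) {1..d}"
      by (intro PiE_ext[OF k(1) zero_freq_mem]) simp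
    then show False using k by simp
  qed
  then obtain i where i: "i \<in> {1..d}" "k i \<noteq> 0" by blast
  have "(\<Sum>i=1..d. 2 * cos (2 * pi * real (k i) / real (n i))) < (\<Sum>i=1..d. 2)"
  proof (rule sum_strict_mono_ex1)
    show "\<exists>i\<in>{1..d}. 2 * cos (2 * pi * real (k i) / real (n i)) < 2"
      using i k(1) cos_frequency_less_1[of "k i" "n i"] by (intro bexI[of _ i]) (auto dest: PiE_mem)
  qed auto
  then show ?thesis by (simp add: torus_eigenvalue_def)
qed

lemma torus_eigenvalues_eq:
  "torus_eigenvalues d n = add_mset 0 (image_mset (torus_eigenvalue d n) (mset_set (torus_nonzero_freqs d n)))"
proof -
  have "mset_set (PiE {1..d} (\<lambda>i. {0..<n i}))
      = add_mset (restrict (\<lambda>_. 0) {1..d}) (mset_set (torus_nonzero_freqs d n))"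
    using zero_freq_mem finite_torus_nonzero_freqs
    by (subst mset_set.insert[symmetric]) (auto simp: torus_nonzero_freqs_def insert_absorb)
  then show ?thesis
    by (simp add: torus_eigenvalues_def torus_eigenvalue_def[abs_def])
qed

lemma nonzero_torus_eigenvalues:
  "{#\<Lambda> \<in># torus_eigenvalues d n. \<Lambda> \<noteq> 0#}
     = image_mset (torus_eigenvalue d n) (mset_set (torus_nonzero_freqs d n))"
proof -
  have "filter_mset (\<lambda>\<Lambda>. \<Lambda> \<noteq> 0) (image_mset (torus_eigenvalue d n) (mset_set (torus_nonzero_freqs d n)))
      = image_mset (torus_eigenvalue d n) (mset_set (torus_nonzero_freqs d n))"
    unfolding filter_mset_eq_conv
    using torus_eigenvalue_pos finite_torus_nonzero_freqs by (fastforce simp: less_le)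
  then show ?thesis by (simp add: torus_eigenvalues_eq)
qed

lemma torus_theta_eq:
  "torus_theta d n t = 1 + (\<Sum>k\<in>torus_nonzero_freqs d n. exp (- torus_eigenvalue d n k * t))"
  by (simp add: torus_theta_def torus_eigenvalues_eq sum_unfold_sum_mset multiset.map_comp comp_def)

section \<open>The determinant formula\<close>

text \<open>The \<open>e\<^sup>-\<^sup>t\<close> terms balance because there are \<open>V(N) - 1\<close> nonzero eigenvalues.\<close>

lemma calH_integrand_eq:
  "calH_integrand d n s t =
     (\<Sum>k\<in>torus_nonzero_freqs d n.
        (exp (- ((s\<^sup>2 + of_real (torus_eigenvalue d n k)) * of_real t)) - of_real (exp (- t))) / of_real t)
     - of_nat (torus_volume d n) * calI_integrand d s t"
proof -
  let ?F = "torus_nonzero_freqs d n" and ?E = "exp (- (s\<^sup>2 * of_real t))"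
  \<comment> \<open>Pulling the common factor \<open>?E\<close> out of the sum leaves the theta
    function without its constant term.\<close>
  have split: "exp (- ((s\<^sup>2 + of_real a) * of_real t)) = ?E * of_real (exp (- a * t))" for a
  proof -
    have "- ((s\<^sup>2 + of_real a) * of_real t) = - (s\<^sup>2 * of_real t) + of_real (- a * t)"
      by (simp add: algebra_simps)
    then show ?thesis by (simp only: exp_add exp_of_real)
  qed
  have "(\<Sum>k\<in>?F. (exp (- ((s\<^sup>2 + of_real (torus_eigenvalue d n k)) * of_real t)) - of_real (exp (- t))) / of_real t)
      = (?E * of_real (torus_theta d n t - 1) - of_nat (card ?F) * of_real (exp (- t))) / of_real t"
    unfolding split sum_divide_distrib[symmetric] sum_subtractf torus_theta_eq
    by (simp add: sum_distrib_left)
  then show ?thesis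
    unfolding calH_integrand_def calI_integrand_def
    by (simp add: torus_volume_eq diff_divide_distrib add_divide_distrib algebra_simps)
qed

text \<open>The integrand of \<open>calH\<close> is a finite sum of Frullani integrands minus a
  multiple of that of \<open>calI\<close>; both parts are integrable, so it can be integrated term
  by term. Positivity of the eigenvalues permits \<open>Re (s\<^sup>2) \<ge> 0\<close>, and thereby
  \<open>s = 0\<close>.\<close>

lemma calH_formula:
  assumes d: "d \<ge> 1" and s: "Re (s\<^sup>2) \<ge> 0"
  shows "set_integrable lborel {0<..} (calH_integrand d n s)"
    and "(\<Sum>\<Lambda>\<in>#{#\<Lambda> \<in># torus_eigenvalues d n. \<Lambda> \<noteq> 0#}. Ln (s\<^sup>2 + of_real \<Lambda>))
             = of_nat (torus_volume d n) * calI d s + calH d n s"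
proof -
  let ?F = "torus_nonzero_freqs d n" and ?V = "of_nat (torus_volume d n) :: complex"
  define g where "g k t = (exp (- ((s\<^sup>2 + of_real (torus_eigenvalue d n k)) * of_real t)) - of_real (exp (- t)))
    / of_real t" for k t
  have pos: "Re (s\<^sup>2 + of_real (torus_eigenvalue d n k)) > 0" if "k \<in> ?F" for k
    using torus_eigenvalue_pos[OF that] s by simp
  have int_g: "integrable lborel (\<lambda>t. indicat_real {0<..} t *\<^sub>R g k t)" if "k \<in> ?F" for k
    using complex_frullani(1)[OF pos[OF that]] by (simp add: g_def[abs_def] set_integrable_def)
  have int_sum: "set_integrable lborel {0<..} (\<lambda>t. \<Sum>k\<in>?F. g k t)"
    unfolding set_integrable_def scaleR_sum_right by (intro Bochner_Integration.integrable_sum int_g)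
  have int_I: "set_integrable lborel {0<..} (\<lambda>t. ?V * calI_integrand d s t)"
    by (intro set_integrable_mult_right calI_integrable d s)
  have H: "calH_integrand d n s = (\<lambda>t. (\<Sum>k\<in>?F. g k t) - ?V * calI_integrand d s t)"
    by (rule ext) (simp add: calH_integrand_eq g_def)
  show "set_integrable lborel {0<..} (calH_integrand d n s)"
    unfolding H using int_sum int_I by (rule set_integral_diff)
  have "(LBINT t:{0<..}. (\<Sum>k\<in>?F. g k t)) = (\<Sum>k\<in>?F. LBINT t:{0<..}. g k t)"
    unfolding set_lebesgue_integral_def scaleR_sum_right
    by (intro Bochner_Integration.integral_sum int_g)
  also have "\<dots> = (\<Sum>k\<in>?F. - Ln (s\<^sup>2 + of_real (torus_eigenvalue d n k)))"
    unfolding g_def by (intro sum.cong refl complex_frullani(2) pos)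
  finally have "calH d n s = (\<Sum>k\<in>?F. Ln (s\<^sup>2 + of_real (torus_eigenvalue d n k))) - ?V * calI d s"
    unfolding calH_def H set_integral_diff(2)[OF int_sum int_I] calI_def
    by (simp add: sum_negf)
  then show "(\<Sum>\<Lambda>\<in>#{#\<Lambda> \<in># torus_eigenvalues d n. \<Lambda> \<noteq> 0#}. Ln (s\<^sup>2 + of_real \<Lambda>))
             = ?V * calI d s + calH d n s"
    by (simp add: nonzero_torus_eigenvalues sum_unfold_sum_mset multiset.map_comp comp_def)
qed

lemma calH_tendsto:
  assumes d: "d \<ge> 1"
  shows "(calH d n \<longlongrightarrow> calH d n 0) (at 0 within {s. Re (s\<^sup>2) > 0})"
proof -
  let ?F = "torus_nonzero_freqs d n" and ?V = "of_nat (torus_volume d n) :: complex"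
  let ?L = "\<lambda>s. (\<Sum>k\<in>?F. Ln (s\<^sup>2 + of_real (torus_eigenvalue d n k))) - ?V * calI d s"
  have eq: "calH d n s = ?L s" if "Re (s\<^sup>2) \<ge> 0" for s
    using calH_formula(2)[OF d that]
    by (simp add: nonzero_torus_eigenvalues sum_unfold_sum_mset multiset.map_comp comp_def algebra_simps)
  have "(?L \<longlongrightarrow> ?L 0) (at 0 within {s. Re (s\<^sup>2) > 0})"
  proof (intro tendsto_intros calI_tendsto d)
    fix k assume "k \<in> ?F"
    \<comment> \<open>The limit point is a positive real, off the branch cut, so \<open>Ln\<close>
      is continuous there.\<close>
    then show "0\<^sup>2 + complex_of_real (torus_eigenvalue d n k) \<notin> \<real>\<^sub>\<le>\<^sub>0"
      using torus_eigenvalue_pos[of k] by (auto simp: complex_nonpos_Reals_iff)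
  qed
  moreover have "\<forall>\<^sub>F s in at 0 within {s. Re (s\<^sup>2) > 0}. ?L s = calH d n s"
    using eq by (auto simp: eventually_at_filter)
  ultimately show ?thesis
    using eq[of 0] by (simp add: tendsto_cong)
qed

lemma calH_zero_eq:
  assumes "d \<ge> 1"
  shows "set_integrable lborel {0<..} (calH_zero_integrand d n)" "calH d n 0 = of_real (calH_zero d n)"
proof -
  have eq: "calH_integrand d n 0 = (\<lambda>t. of_real (calH_zero_integrand d n t))"
    by (simp add: fun_eq_iff calH_integrand_def calH_zero_integrand_def)
  show "set_integrable lborel {0<..} (calH_zero_integrand d n)"
    using calH_formula(1)[OF assms, of 0] unfolding eq set_integrable_def
    by (simp add: scaleR_conv_of_real complex_of_real_integrable_eq flip: of_real_mult)
  show "calH d n 0 = of_real (calH_zero d n)"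
    by (simp add: calH_def calH_zero_def eq set_integral_complex_of_real)
qed

text \<open>The determinant formula is evaluated directly at \<open>s = 0\<close>, where each
  \<open>Ln\<close> of a positive real is the real logarithm.\<close>

lemma ln_prod_torus_eigenvalues:
  assumes "d \<ge> 1"
  shows "ln (\<Prod>\<Lambda>\<in>#{#\<Lambda> \<in># torus_eigenvalues d n. \<Lambda> \<noteq> 0#}. \<Lambda>)
           = real (torus_volume d n) * calI_zero d + calH_zero d n"
proof -
  let ?F = "torus_nonzero_freqs d n"
  have "ln (\<Prod>k\<in>?F. torus_eigenvalue d n k) = (\<Sum>k\<in>?F. ln (torus_eigenvalue d n k))"
    by (rule ln_prod[OF finite_torus_nonzero_freqs]) (use torus_eigenvalue_pos in fastforce)
  then have "of_real (ln (\<Prod>\<Lambda>\<in>#{#\<Lambda> \<in># torus_eigenvalues d n. \<Lambda> \<noteq> 0#}. \<Lambda>))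
      = complex_of_real (\<Sum>k\<in>?F. ln (torus_eigenvalue d n k))"
    by (simp add: nonzero_torus_eigenvalues prod_unfold_prod_mset)
  also have "\<dots> = (\<Sum>k\<in>?F. Ln (0\<^sup>2 + of_real (torus_eigenvalue d n k)))"
    using torus_eigenvalue_pos by (simp add: Ln_of_real)
  also have "\<dots> = of_nat (torus_volume d n) * calI d 0 + calH d n 0"
    using calH_formula(2)[OF assms, of 0]
    by (simp add: nonzero_torus_eigenvalues sum_unfold_sum_mset multiset.map_comp comp_def)
  also have "\<dots> = of_real (real (torus_volume d n) * calI_zero d + calH_zero d n)"
    by (simp add: calI_zero_eq(2)[OF assms] calH_zero_eq(2)[OF assms])
  finally show ?thesis
    using of_real_eq_iff by blast
qed

end

theorem theorem3p6:
  fixes d :: nat and n :: "nat \<Rightarrow> nat"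
  assumes "d \<ge> 1" and "\<And>i. i \<in> {1..d} \<Longrightarrow> n i \<ge> 1"
  shows "(\<forall>s::complex. Re (s^2) > 0 \<longrightarrow>
           set_integrable lborel {0<..} (calI_integrand d s) \<and>
           set_integrable lborel {0<..} (calH_integrand d n s) \<and>
           (\<Sum>\<Lambda>\<in>#{#\<Lambda> \<in># torus_eigenvalues d n. \<Lambda> \<noteq> 0#}. Ln (s^2 + of_real \<Lambda>))
             = of_nat (torus_volume d n) * calI d s + calH d n s) \<and>
    (calI d \<longlongrightarrow> of_real (calI_zero d)) (at 0 within {s. Re (s^2) > 0}) \<and>
    (calH d n \<longlongrightarrow> of_real (calH_zero d n)) (at 0 within {s. Re (s^2) > 0}) \<and>
    set_integrable lborel {0<..} (calI_zero_integrand d) \<and>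
    set_integrable lborel {0<..} (calH_zero_integrand d n) \<and>
    ln (\<Prod>\<Lambda>\<in>#{#\<Lambda> \<in># torus_eigenvalues d n. \<Lambda> \<noteq> 0#}. \<Lambda>)
           = real (torus_volume d n) * calI_zero d + calH_zero d n"
proof (intro conjI allI impI)
  fix s :: complex assume "Re (s^2) > 0"
  then have s: "Re (s^2) \<ge> 0" by simp
  show "set_integrable lborel {0<..} (calI_integrand d s)"
    by (rule calI_integrable[OF assms(1) s])
  show "set_integrable lborel {0<..} (calH_integrand d n s)"
    by (rule calH_formula(1)[OF assms(2) assms(1) s])
  show "(\<Sum>\<Lambda>\<in>#{#\<Lambda> \<in># torus_eigenvalues d n. \<Lambda> \<noteq> 0#}. Ln (s^2 + of_real \<Lambda>))
             = of_nat (torus_volume d n) * calI d s + calH d n s"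
    by (rule calH_formula(2)[OF assms(2) assms(1) s])
next
  show "(calI d \<longlongrightarrow> of_real (calI_zero d)) (at 0 within {s. Re (s^2) > 0})"
    using calI_tendsto[OF assms(1)] by (simp only: calI_zero_eq(2)[OF assms(1)])
  show "(calH d n \<longlongrightarrow> of_real (calH_zero d n)) (at 0 within {s. Re (s^2) > 0})"
    using calH_tendsto[OF assms(2) assms(1)] by (simp only: calH_zero_eq(2)[OF assms(2) assms(1)])
  show "set_integrable lborel {0<..} (calI_zero_integrand d)"
    by (rule calI_zero_eq(1)[OF assms(1)])
  show "set_integrable lborel {0<..} (calH_zero_integrand d n)"
    by (rule calH_zero_eq(1)[OF assms(2) assms(1)])
  show "ln (\<Prod>\<Lambda>\<in>#{#\<Lambda> \<in># torus_eigenvalues d n. \<Lambda> \<noteq> 0#}. \<Lambda>)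
           = real (torus_volume d n) * calI_zero d + calH_zero d n"
    by (rule ln_prod_torus_eigenvalues[OF assms(2) assms(1)])
qed

end
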